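(* Let $F(x,y)\in\mathbb{Q}[x,y]$ be a polynomial of degree $d$. Then there exist polynomials $K_{F,k}(x)\in\mathbb{Q}[x]$, $0\le k\le\lfloor (d+1)/2\rfloor$, depending only on $F$ and $k$ and each of degree at most $d+1$, such that for every positive integer $n\ge d+2$, $$\sum_{\substack{j+k=n\\ j,k\ge1}}F(j,k)\,\zeta(2j)\zeta(2k)=\sum_{k=0}^{\lfloor (d+1)/2\rfloor}K_{F,k}(n)\,\zeta(2k)\zeta(2n-2k).$$
   Context: $\zeta$ denotes the Riemann zeta function; in particular $\zeta(0)=-1/2$. *)

theory Defs
  imports
    "HOL-Complex_Analysis.Complex_Analysis"
    "HOL-Computational_Algebra.Polynomial"
begin

text \<open>
  The Riemann zeta function as the holomorphic continuation of its Dirichlet series to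
  \<open>\<complex> - {1}\<close>. The continuation is unique by the identity theorem; the value at
  the pole is set to 0, only so that a unique total function is described.
\<close>

definition zeta :: "complex \<Rightarrow> complex" where
  "zeta = (THE f. f holomorphic_on - {1} \<and> f 1 = 0 \<and>
             (\<forall>s. Re s > 1 \<longrightarrow> (\<lambda>n. 1 / of_nat (Suc n) powr s) sums f s))"

text \<open>
  Bivariate polynomials \<open>F(x,y)\<close> are elements of \<open>R[x][y]\<close>: the inner variable is \<open>x\<close>, the
  outer one is \<open>y\<close>, so the coefficient of \<open>x\<^sup>i y\<^sup>j\<close> is \<open>coeff (coeff F j) i\<close>.
  The total degree of the zero polynomial is 0, as for \<open>degree\<close>.
\<close>

definition poly2 :: "'a::comm_semiring_0 poly poly \<Rightarrow> 'a \<Rightarrow> 'a \<Rightarrow> 'a" where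
  "poly2 F x y = poly (poly F [:y:]) x"

definition total_degree :: "'a::zero poly poly \<Rightarrow> nat" where
  "total_degree F = Max (insert 0 {i + j | i j. coeff (coeff F j) i \<noteq> 0})"

end

theory Submission
  imports Defs
begin

text \<open>
  The generating function \<open>f = \<Sum> \<zeta>(2k) x\<^sup>k = -(\<pi> \<surd>x / 2) cot (\<pi> \<surd>x)\<close> satisfies, with
  \<open>\<theta> = x d/dx\<close> and \<open>u = 3/2 \<zeta>(2) x\<close>, the equation \<open>\<theta> f = f\<^sup>2 + f/2 + u\<close>. Giving \<open>f\<close> weight 1 and
  \<open>u\<close> weight 2, the product \<open>\<theta>\<^sup>a f \<cdot> \<theta>\<^sup>b f\<close> is a polynomial in \<open>f\<close> and \<open>u\<close> of weight at most
  \<open>a + b + 2\<close>. Since \<open>\<theta>\<^sup>l f\<close> equals \<open>l! f\<^bsup>l+1\<^esup>\<close> up to lower powers of \<open>f\<close>, any such polynomial is a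
  combination of terms \<open>u\<^sup>i \<theta>\<^sup>l f\<close> with \<open>l + 2i \<le> a + b + 1\<close> and powers of \<open>u\<close>; the coefficient
  of \<open>x\<^sup>n\<close> in \<open>u\<^sup>i \<theta>\<^sup>l f\<close> is a rational multiple of \<open>(n - i)\<^sup>l \<zeta>(2i) \<zeta>(2n - 2i)\<close>, because \<open>\<zeta>(2i)\<close>
  is a nonzero rational multiple of \<open>\<zeta>(2)\<^sup>i\<close>.

  The continuation of \<open>\<zeta>\<close> comes from summing the binomial expansions of
  \<open>(n + 1)\<^bsup>1-s\<^esup> - n\<^bsup>1-s\<^esup>\<close> over \<open>n\<close>, which expresses \<open>(s - 1) \<zeta>(s)\<close> through the values
  \<open>\<zeta>(s + 1), \<zeta>(s + 2), \<dots>\<close> and a remainder converging further to the left.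
\<close>

subsection \<open>Analytic continuation of the zeta function\<close>

text \<open>The derivative of the remainder of order \<open>M + 1\<close> at exponent
  \<open>a\<close> is \<open>a\<close> times the remainder of order \<open>M\<close> at
  \<open>a - 1\<close>, so the mean value inequality on [0, x] gains one factor x per order. A
  single \<open>C\<close> for all \<open>a\<close> of bounded norm is what the uniform convergence
  below requires.\<close>

lemma binomial_remainder_bound:
  fixes A :: real
  shows "\<exists>C\<ge>0. \<forall>(a::complex) x::real. norm a \<le> A \<longrightarrow> 0 \<le> x \<longrightarrow> x \<le> 1 \<longrightarrow>
           norm ((1 + of_real x) powr a - (\<Sum>k<M. (a gchoose k) * of_real x ^ k)) \<le> C * x ^ M"
proof (induction M arbitrary: A)
  case 0
  show ?case
  proof (intro exI[of _ "2 powr A"] conjI allI impI)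
    fix a :: complex and x :: real
    assume a: "norm a \<le> A" and x: "0 \<le> x" "x \<le> 1"
    have "norm ((1 + of_real x) powr a) = (1 + x) powr Re a"
      using x by (subst norm_powr_real_powr) auto
    also have "\<dots> \<le> (1 + x) powr A"
      using x a complex_Re_le_cmod[of a] by (intro powr_mono) auto
    also have "\<dots> \<le> 2 powr A"
      using x order.trans[OF norm_ge_zero a] by (intro powr_mono2) auto
    finally show "norm ((1 + of_real x) powr a - (\<Sum>k<0. (a gchoose k) * of_real x ^ k)) \<le> 2 powr A * x ^ 0"
      by simp
  qed auto
next
  case (Suc M)
  define R where "R = (\<lambda>M (a::complex) z. (1 + z) powr a - (\<Sum>k<M. (a gchoose k) * z ^ k))"
  \<comment> \<open>The exponent drops to \<open>a - 1\<close>, whose norm may reach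
    \<open>A + 1\<close>. The absolute value keeps the new constant \<open>\<bar>A\<bar> * C\<close>
    nonnegative when \<open>A\<close> is negative.\<close>
  from Suc.IH[of "\<bar>A\<bar> + 1"] obtain C where C: "C \<ge> 0"
    "\<And>a x. norm a \<le> \<bar>A\<bar> + 1 \<Longrightarrow> 0 \<le> x \<Longrightarrow> x \<le> 1 \<Longrightarrow> norm (R M a (of_real x)) \<le> C * x ^ M"
    unfolding R_def by blast
  have "norm (R (Suc M) a (of_real x)) \<le> \<bar>A\<bar> * C * x ^ Suc M"
    if a: "norm a \<le> A" and x: "0 \<le> x" "x \<le> 1" for a x
  proof -
    let ?S = "of_real ` {0..x} :: complex set"
    have deriv: "(R (Suc M) a has_field_derivative a * R M (a - 1) z) (at z within ?S)" if "z \<in> ?S" for z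
    proof -
      from that have z: "1 + z \<notin> \<real>\<^sub>\<le>\<^sub>0" by (auto simp: complex_nonpos_Reals_iff)
      have "(\<Sum>k<Suc M. (a gchoose k) * (of_nat k * z ^ (k - Suc 0))) =
            (\<Sum>k<M. of_nat (Suc k) * (a gchoose Suc k) * z ^ k)"
        by (subst sum.lessThan_Suc_shift) (simp add: mult_ac)
      also have "\<dots> = a * (\<Sum>k<M. (a - 1 gchoose k) * z ^ k)"
        by (simp only: gbinomial_absorption sum_distrib_left mult.assoc)
      finally have eq: "(\<Sum>k<Suc M. (a gchoose k) * (of_nat k * z ^ (k - Suc 0))) =
         a * (\<Sum>k<M. (a - 1 gchoose k) * z ^ k)" .
      have "(R (Suc M) a has_field_derivative a * (1 + z) powr (a - 1) -
              (\<Sum>k<Suc M. (a gchoose k) * (of_nat k * z ^ (k - Suc 0)))) (at z within ?S)"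
        unfolding R_def
      proof (intro DERIV_diff DERIV_sum)
        show "((\<lambda>z. (1 + z) powr a) has_field_derivative a * (1 + z) powr (a - 1)) (at z within ?S)"
          using z by (auto intro!: derivative_eq_intros)
        show "((\<lambda>z. (a gchoose k) * z ^ k) has_field_derivative
                (a gchoose k) * (of_nat k * z ^ (k - Suc 0))) (at z within ?S)" for k
          by (auto intro!: derivative_eq_intros)
      qed
      thus ?thesis unfolding eq by (simp add: R_def algebra_simps)
    qed
    have "norm (R (Suc M) a (of_real x) - R (Suc M) a 0) \<le> (\<bar>A\<bar> * C * x ^ M) * norm (of_real x - 0 :: complex)"
    proof (rule field_differentiable_bound[of ?S])
      show "convex ?S" by (intro convex_linear_image) (auto simp: linear_iff scaleR_conv_of_real)
      show "norm (a * R M (a - 1) z) \<le> \<bar>A\<bar> * C * x ^ M" if z: "z \<in> ?S" for z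
      proof -
        from z obtain y where y: "z = of_real y" "0 \<le> y" "y \<le> x" by auto
        have "norm (a - 1) \<le> \<bar>A\<bar> + 1" using a norm_triangle_ineq4[of a 1] by simp
        hence "norm (R M (a - 1) z) \<le> C * y ^ M" unfolding y using C(2) y x by simp
        also have "\<dots> \<le> C * x ^ M" using y C by (intro mult_left_mono power_mono) auto
        finally show ?thesis using a by (simp add: norm_mult mult.assoc mult_mono)
      qed
    qed (use deriv x in \<open>auto simp: image_iff\<close>)
    moreover have "R (Suc M) a 0 = 0"
      unfolding R_def by (subst sum.lessThan_Suc_shift) simp
    ultimately show ?thesis using x by (simp add: mult_ac)
  qed
  thus ?case using C unfolding R_def by (intro exI[of _ "\<bar>A\<bar> * C"]) auto
qed

section \<open>The Dirichlet series and its telescoping recurrence\<close>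

definition zeta_series :: "complex \<Rightarrow> complex" where
  "zeta_series s = (\<Sum>n. 1 / of_nat (Suc n) powr s)"

text \<open>With m = n + 1, this is the error after \<open>M\<close> terms when (m + 1)^(1-s) =
  m^(1-s) (1 + 1/m)^(1-s) is expanded in powers of 1/m.\<close>

definition telescope_remainder :: "nat \<Rightarrow> complex \<Rightarrow> nat \<Rightarrow> complex" where
  "telescope_remainder M s n = of_nat (Suc (Suc n)) powr (1 - s)
     - (\<Sum>k<M. ((1 - s) gchoose k) * of_nat (Suc n) powr (1 - s - of_nat k))"

lemma summable_zeta_series:
  assumes "Re s > 1"
  shows "summable (\<lambda>n. 1 / of_nat (Suc n) powr s)"
proof -
  have "summable (\<lambda>n. exp (of_real (ln (real n)) * (-s)))"
    using assms by (intro summable_complex_powr_iff) auto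
  hence "summable (\<lambda>n. exp (of_real (ln (real (Suc n))) * (-s)))"
    by (rule summable_Suc_iff[THEN iffD2])
  also have "(\<lambda>n. exp (of_real (ln (real (Suc n))) * (-s))) = (\<lambda>n. of_nat (Suc n) powr (-s))"
    by (intro ext) (simp add: powr_def Ln_of_nat mult_ac del: of_nat_Suc)
  finally have "summable (\<lambda>n. of_nat (Suc n) powr (-s))" .
  thus ?thesis by (simp add: powr_minus field_simps)
qed

text \<open>Apply \<open>binomial_remainder_bound\<close> with x = 1/(n + 1) and a = 1 - s; the
  constant depends on \<open>s\<close> only through the bound \<open>A\<close>.\<close>

lemma telescope_remainder_bound:
  "\<exists>C\<ge>0. \<forall>s n. norm (1 - s) \<le> A \<longrightarrow>
     norm (telescope_remainder M s n) \<le> C * real (Suc n) powr (1 - Re s - real M)"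
proof -
  from binomial_remainder_bound[of A M] obtain C where C: "C \<ge> 0"
    "\<And>a x. norm (a::complex) \<le> A \<Longrightarrow> 0 \<le> x \<Longrightarrow> x \<le> 1 \<Longrightarrow>
       norm ((1 + of_real x) powr a - (\<Sum>k<M. (a gchoose k) * of_real x ^ k)) \<le> C * x ^ M"
    by blast
  have "norm (telescope_remainder M s n) \<le> C * real (Suc n) powr (1 - Re s - real M)"
    if "norm (1 - s) \<le> A" for s n
  proof -
    define m where "m = Suc n"
    have m: "m > 0" by (simp add: m_def)
    have "of_nat (Suc m) = of_nat m * (1 + of_real (1 / real m) :: complex)"
      using m by (simp add: field_simps)
    hence 1: "of_nat (Suc m) powr (1 - s) = of_nat m powr (1 - s) * (1 + of_real (1 / real m)) powr (1 - s)"
      using powr_times_real[of "of_nat m" "1 + of_real (1 / real m)" "1 - s"] by simp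
    have 2: "of_nat m powr (1 - s - of_nat k) = of_nat m powr (1 - s) * of_real (1 / real m) ^ k" for k
      using m by (simp add: powr_diff[of _ "1 - s"] power_divide)
    have "telescope_remainder M s n = of_nat m powr (1 - s) * ((1 + of_real (1 / real m)) powr (1 - s)
       - (\<Sum>k<M. ((1 - s) gchoose k) * of_real (1 / real m) ^ k))"
      unfolding telescope_remainder_def m_def[symmetric] 1 2
      by (simp only: right_diff_distrib sum_distrib_left mult_ac)
    also have "norm \<dots> \<le> real m powr (1 - Re s) * (C * (1 / real m) ^ M)"
      unfolding norm_mult using m that
      by (intro mult_mono C) (auto simp: norm_powr_real_powr)
    also have "\<dots> = C * real m powr (1 - Re s - real M)"
      using m by (simp add: powr_diff[of _ "1 - Re s"] powr_realpow power_divide)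
    finally show ?thesis by (simp add: m_def)
  qed
  with C(1) show ?thesis by blast
qed

lemma telescope_remainder_holomorphic: "(\<lambda>s. telescope_remainder M s n) holomorphic_on X"
  unfolding telescope_remainder_def gbinomial_prod_rev by (intro holomorphic_intros) auto

lemma summable_Suc_powr: "e < -1 \<Longrightarrow> summable (\<lambda>n. real (Suc n) powr e)"
  using summable_real_powr_iff[of e] by (subst summable_Suc_iff) auto

text \<open>The exponent 1 - Re s - M is below -1 exactly on this half-plane, so the Weierstrass
  test gives uniform convergence on small closed discs.\<close>

lemma suminf_telescope_remainder_holomorphic:
  "(\<lambda>s. \<Sum>n. telescope_remainder M s n) holomorphic_on {s. Re s > 2 - real M}"
proof (rule holomorphic_uniform_sequence)
  show "open {s. Re s > 2 - real M}" by (rule open_halfspace_Re_gt)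
  show "(\<lambda>s. \<Sum>n<N. telescope_remainder M s n) holomorphic_on {s. Re s > 2 - real M}" for N
    by (intro holomorphic_intros telescope_remainder_holomorphic)
  fix x assume "x \<in> {s. Re s > 2 - real M}"
  \<comment> \<open>Half the distance to the boundary line, so that the closed disc stays inside the
    half-plane.\<close>
  then obtain d where d: "d > 0" "Re x - d > 2 - real M"
    by (auto intro!: that[of "(Re x - (2 - real M)) / 2"] simp: field_simps)
  have Re: "Re s \<ge> Re x - d" if "s \<in> cball x d" for s
    using that abs_Re_le_cmod[of "x - s"] by (auto simp: dist_norm)
  obtain C where C: "C \<ge> 0" "\<And>s n. norm (1 - s) \<le> norm (1 - x) + d \<Longrightarrow>
      norm (telescope_remainder M s n) \<le> C * real (Suc n) powr (1 - Re s - real M)"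
    using telescope_remainder_bound[of "norm (1 - x) + d" M] by blast
  have "uniform_limit (cball x d) (\<lambda>N s. \<Sum>n<N. telescope_remainder M s n)
           (\<lambda>s. \<Sum>n. telescope_remainder M s n) sequentially"
  proof (rule Weierstrass_m_test)
    show "summable (\<lambda>n. C * real (Suc n) powr (1 - (Re x - d) - real M))"
      using d by (intro summable_mult summable_Suc_powr) auto
    fix n s assume s: "s \<in> cball x d"
    have "norm (1 - s) \<le> norm (1 - x) + norm (x - s)"
      using norm_triangle_ineq[of "1 - x" "x - s"] by simp
    hence "norm (1 - s) \<le> norm (1 - x) + d" using s by (simp add: dist_norm)
    from C(2)[OF this, of n] have "norm (telescope_remainder M s n) \<le> C * real (Suc n) powr (1 - Re s - real M)" .
    also have "\<dots> \<le> C * real (Suc n) powr (1 - (Re x - d) - real M)"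
      using C(1) Re[OF s] by (intro mult_left_mono powr_mono) auto
    finally show "norm (telescope_remainder M s n) \<le> C * real (Suc n) powr (1 - (Re x - d) - real M)" .
  qed
  moreover have "cball x d \<subseteq> {s. Re s > 2 - real M}" using Re d by force
  ultimately show "\<exists>d>0. cball x d \<subseteq> {s. Re s > 2 - real M} \<and>
     uniform_limit (cball x d) (\<lambda>N s. \<Sum>n<N. telescope_remainder M s n)
           (\<lambda>s. \<Sum>n. telescope_remainder M s n) sequentially"
    using d by blast
qed

text \<open>Sum the remainders over n. The term k = 0 turns the leading power into a telescoping
  difference with sum -1, the term k = 1 gives (1 - s) \<zeta>(s), and the others give \<zeta>(s + k
  - 1).\<close>

lemma zeta_series_recurrence:
  assumes s: "Re s > 1" and M: "M \<ge> 2"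
  shows "(s - 1) * zeta_series s = 1 + (\<Sum>k=2..<M. ((1 - s) gchoose k) * zeta_series (s + of_nat k - 1))
           + (\<Sum>n. telescope_remainder M s n)"
proof -
  have "(\<lambda>n. of_nat n powr (1 - s)) \<longlonglongrightarrow> (0 :: complex)"
    using s by (intro tendsto_neg_powr_complex_of_nat filterlim_ident) auto
  hence "(\<lambda>n. of_nat (Suc n) powr (1 - s)) \<longlonglongrightarrow> (0 :: complex)"
    by (rule LIMSEQ_Suc)
  from telescope_sums[OF this]
  have tele: "(\<lambda>n. of_nat (Suc (Suc n)) powr (1 - s) - of_nat (Suc n) powr (1 - s)) sums (-1)"
    by simp
  have Z: "(\<lambda>n. of_nat (Suc n) powr (1 - s - of_nat k)) sums zeta_series (s + of_nat k - 1)"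
    if "k \<ge> 1" for k
  proof -
    have "of_nat (Suc n) powr (1 - s - of_nat k) = 1 / of_nat (Suc n) powr (s + of_nat k - 1)" for n
      using powr_minus[of "of_nat (Suc n)" "s + of_nat k - 1"] by (simp add: field_simps)
    moreover have "(\<lambda>n. 1 / of_nat (Suc n) powr (s + of_nat k - 1)) sums zeta_series (s + of_nat k - 1)"
      unfolding zeta_series_def using s that by (intro summable_sums summable_zeta_series) auto
    ultimately show ?thesis by simp
  qed
  have "{..<M} = insert 0 (insert 1 {2..<M})" using M by auto
  hence "telescope_remainder M s n = (of_nat (Suc (Suc n)) powr (1 - s) - of_nat (Suc n) powr (1 - s))
      - ((1 - s) * of_nat (Suc n) powr (1 - s - of_nat 1)
      + (\<Sum>k=2..<M. ((1 - s) gchoose k) * of_nat (Suc n) powr (1 - s - of_nat k)))" for n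
    unfolding telescope_remainder_def by simp
  hence "telescope_remainder M s = (\<lambda>n. (of_nat (Suc (Suc n)) powr (1 - s) - of_nat (Suc n) powr (1 - s))
      - ((1 - s) * of_nat (Suc n) powr (1 - s - of_nat 1)
      + (\<Sum>k=2..<M. ((1 - s) gchoose k) * of_nat (Suc n) powr (1 - s - of_nat k))))" by blast
  moreover have "\<dots> sums (-1 - ((1 - s) * zeta_series (s + of_nat 1 - 1)
      + (\<Sum>k=2..<M. ((1 - s) gchoose k) * zeta_series (s + of_nat k - 1))))"
    by (intro sums_diff tele sums_add sums_mult sums_sum Z) auto
  ultimately have "suminf (telescope_remainder M s) = -1 - ((1 - s) * zeta_series (s + of_nat 1 - 1)
      + (\<Sum>k=2..<M. ((1 - s) gchoose k) * zeta_series (s + of_nat k - 1)))"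
    by (simp add: sums_iff)
  thus ?thesis by (simp add: algebra_simps)
qed

section \<open>Continuation from half-plane to half-plane\<close>

text \<open>The factor s - 1 removes the pole, so the half-planes need no puncture.\<close>

definition continues_zeta :: "nat \<Rightarrow> (complex \<Rightarrow> complex) \<Rightarrow> bool" where
  "continues_zeta M \<phi> \<longleftrightarrow> \<phi> holomorphic_on {s. Re s > 2 - real M} \<and>
     (\<forall>s. Re s > 1 \<longrightarrow> \<phi> s = (s - 1) * zeta_series s)"

text \<open>
  The factor \<open>s + k - 2\<close> of \<open>(1 - s) gchoose k\<close> cancels the pole of \<open>\<zeta>(s + k - 1)\<close>.
\<close>

definition reduced_gchoose :: "nat \<Rightarrow> complex \<Rightarrow> complex" where
  "reduced_gchoose k s = - (\<Prod>i<k - 1. 1 - s - of_nat i) / fact k"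

lemma reduced_gchoose:
  assumes "k \<ge> 2"
  shows "((1 - s) gchoose k) = reduced_gchoose k s * (s + of_nat k - 1 - 1)"
proof -
  obtain j where k: "k = Suc j" using assms by (cases k) auto
  define P where "P = (\<Prod>i<j. 1 - s - of_nat i)"
  have "((1 - s) gchoose k) = P * (1 - s - of_nat j) / fact k"
    by (simp add: gbinomial_prod_rev k P_def atLeast0LessThan)
  also have "P * (1 - s - of_nat j) = - P * (s + of_nat k - 1 - 1)"
    by (simp add: k algebra_simps)
  finally show ?thesis by (simp add: reduced_gchoose_def k P_def)
qed

text \<open>For M = 2 the sum over k in the recurrence is empty.\<close>

lemma continues_zeta_2: "continues_zeta 2 (\<lambda>s. 1 + (\<Sum>n. telescope_remainder 2 s n))"
  unfolding continues_zeta_def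
  using zeta_series_recurrence[of _ 2] suminf_telescope_remainder_holomorphic[of 2]
  by (auto intro!: holomorphic_intros)

text \<open>Since k \<ge> 2, the argument s + k - 1 lies at least one unit to the right of s, so
  \<open>\<phi>\<close> is evaluated only where it is already known to be holomorphic.\<close>

lemma continues_zeta_Suc:
  assumes "continues_zeta M \<phi>" "M \<ge> 2"
  shows "continues_zeta (Suc M) (\<lambda>s. 1 + (\<Sum>k=2..<Suc M. reduced_gchoose k s * \<phi> (s + of_nat k - 1))
           + (\<Sum>n. telescope_remainder (Suc M) s n))"
  unfolding continues_zeta_def
proof (intro conjI allI impI)
  show "(\<lambda>s. 1 + (\<Sum>k=2..<Suc M. reduced_gchoose k s * \<phi> (s + of_nat k - 1))
           + (\<Sum>n. telescope_remainder (Suc M) s n)) holomorphic_on {s. Re s > 2 - real (Suc M)}"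
  proof (intro holomorphic_on_add holomorphic_on_sum holomorphic_on_mult
           suminf_telescope_remainder_holomorphic holomorphic_on_const)
    fix k assume k: "k \<in> {2..<Suc M}"
    show "reduced_gchoose k holomorphic_on {s. Re s > 2 - real (Suc M)}"
      unfolding reduced_gchoose_def by (intro holomorphic_intros) auto
    show "(\<lambda>s. \<phi> (s + of_nat k - 1)) holomorphic_on {s. Re s > 2 - real (Suc M)}"
      using assms(1) unfolding continues_zeta_def
      by (intro holomorphic_on_compose_gen[of "\<lambda>s. s + of_nat k - 1" _ \<phi> "{s. Re s > 2 - real M}", unfolded o_def])
         (use k in \<open>auto intro!: holomorphic_intros\<close>)
  qed
next
  fix s :: complex assume s: "Re s > 1"
  have "(s - 1) * zeta_series s = 1 + (\<Sum>k=2..<Suc M. ((1 - s) gchoose k) * zeta_series (s + of_nat k - 1))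
           + (\<Sum>n. telescope_remainder (Suc M) s n)"
    using s assms(2) by (intro zeta_series_recurrence) auto
  also have "(\<Sum>k=2..<Suc M. ((1 - s) gchoose k) * zeta_series (s + of_nat k - 1)) =
             (\<Sum>k=2..<Suc M. reduced_gchoose k s * \<phi> (s + of_nat k - 1))"
  proof (rule sum.cong)
    fix k assume k: "k \<in> {2..<Suc M}"
    hence "\<phi> (s + of_nat k - 1) = (s + of_nat k - 1 - 1) * zeta_series (s + of_nat k - 1)"
      using assms(1) s unfolding continues_zeta_def by auto
    thus "((1 - s) gchoose k) * zeta_series (s + of_nat k - 1) = reduced_gchoose k s * \<phi> (s + of_nat k - 1)"
      using k by (simp add: reduced_gchoose)
  qed auto
  finally show "1 + (\<Sum>k=2..<Suc M. reduced_gchoose k s * \<phi> (s + of_nat k - 1))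
           + (\<Sum>n. telescope_remainder (Suc M) s n) = (s - 1) * zeta_series s" by simp
qed

lemma continues_zeta_exists: "\<exists>\<phi>. continues_zeta M \<phi>"
proof -
  have "\<exists>\<phi>. continues_zeta (M + 2) \<phi>"
  proof (induction M)
    case 0
    show ?case using continues_zeta_2 by (auto simp: eval_nat_numeral)
  next
    case (Suc M)
    then obtain \<phi> where "continues_zeta (M + 2) \<phi>" by blast
    from continues_zeta_Suc[OF this] show ?case by auto
  qed
  then obtain \<phi> where "continues_zeta (M + 2) \<phi>" by blast
  hence "continues_zeta M \<phi>"
    unfolding continues_zeta_def by (auto elim!: holomorphic_on_subset)
  thus ?thesis by blast
qed

lemma continues_zeta_unique:
  assumes "continues_zeta M \<phi>" "continues_zeta N \<psi>" "Re s > 2 - real M" "Re s > 2 - real N"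
  shows "\<phi> s = \<psi> s"
proof -
  let ?S = "{s. Re s > 2 - real (min M N)}"
  have hol: "\<phi> holomorphic_on ?S" "\<psi> holomorphic_on ?S"
    using assms(1,2) unfolding continues_zeta_def by (auto elim!: holomorphic_on_subset)
  show ?thesis
  \<comment> \<open>The half-plane Re s > 2 lies inside \<open>?S\<close> even when \<open>M\<close>
    or \<open>N\<close> is 0, which Re s > 1 would not.\<close>
  proof (rule analytic_continuation_open[of "{s. Re s > 2}" ?S \<phi> \<psi>])
    show "{s. Re s > 2} \<noteq> {}" by (auto intro!: exI[of _ "3::complex"])
    show "connected ?S" by (intro convex_connected convex_halfspace_Re_gt)
  qed (use hol assms(3,4) assms(1,2)[unfolded continues_zeta_def] in \<open>auto simp: open_halfspace_Re_gt\<close>)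
qed

lemma zeta_continuation:
  obtains \<phi> where "\<phi> holomorphic_on UNIV" "\<And>s. Re s > 1 \<Longrightarrow> \<phi> s = (s - 1) * zeta_series s" "\<phi> 0 = 1 / 2"
proof -
  obtain \<Phi> where \<Phi>: "\<And>M. continues_zeta M (\<Phi> M)" using continues_zeta_exists by metis
  \<comment> \<open>Since Re s \<ge> -|s|, this index is large enough for s to lie in its
    half-plane; by uniqueness every other admissible index gives the same value.\<close>
  define \<phi> where "\<phi> s = \<Phi> (nat \<lceil>norm s\<rceil> + 3) s" for s
  have dom: "Re s > 2 - real (nat \<lceil>norm s\<rceil> + 3)" for s :: complex
    using abs_Re_le_cmod[of s] real_nat_ceiling_ge[of "norm s"] by linarith
  have \<phi>: "\<phi> s = \<psi> s" if "continues_zeta M \<psi>" "Re s > 2 - real M" for s M \<psi>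
    unfolding \<phi>_def using continues_zeta_unique[OF \<Phi> that(1) dom that(2)] .
  have "\<phi> field_differentiable (at s)" for s
  proof -
    define M where "M = nat \<lceil>norm s\<rceil> + 3"
    have "\<Phi> M holomorphic_on {s. Re s > 2 - real M}" using \<Phi> by (simp add: continues_zeta_def)
    moreover have "\<phi> holomorphic_on {s. Re s > 2 - real M} \<longleftrightarrow> \<Phi> M holomorphic_on {s. Re s > 2 - real M}"
      by (intro holomorphic_cong refl \<phi>[OF \<Phi>]) auto
    ultimately show ?thesis
      using dom[of s] by (auto simp: M_def open_halfspace_Re_gt holomorphic_on_open field_differentiable_def)
  qed
  hence "\<phi> holomorphic_on UNIV" by (simp add: holomorphic_on_def)
  moreover have "\<phi> s = (s - 1) * zeta_series s" if "Re s > 1" for s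
    using that \<Phi> dom[of s] unfolding \<phi>_def continues_zeta_def by blast
  moreover have "\<phi> 0 = 1 / 2"
  proof -
    \<comment> \<open>At s = 1 and s = 0 the expansions of (m + 1)^0 and (m + 1)^1 are exact, so the
      remainders vanish. The recurrence at 0 then leaves 1 plus the term k = 2, which is
      -1/2.\<close>
    have "telescope_remainder 2 1 = (\<lambda>_. 0)"
      by (simp add: telescope_remainder_def fun_eq_iff numeral_2_eq_2 del: of_nat_Suc)
    moreover have "telescope_remainder 3 0 = (\<lambda>_. 0)"
      by (simp add: telescope_remainder_def fun_eq_iff eval_nat_numeral gbinomial_prod_rev
            of_nat_neq_0[unfolded of_nat_Suc])
    moreover have "\<phi> 0 = 1 + (\<Sum>k=2..<Suc 2. reduced_gchoose k 0 * (1 + (\<Sum>n. telescope_remainder 2 (0 + of_nat k - 1) n)))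
           + (\<Sum>n. telescope_remainder (Suc 2) 0 n)"
      by (rule \<phi>[OF continues_zeta_Suc[OF continues_zeta_2]]) auto
    ultimately show ?thesis by (simp add: reduced_gchoose_def eval_nat_numeral)
  qed
  ultimately show ?thesis by (rule that)
qed

text \<open>The quotient \<phi>(s) / (s - 1), set to 0 at the pole, meets the description in
  \<open>zeta_def\<close>; the identity theorem on the connected punctured plane makes it the only
  such function.\<close>

lemma zeta_properties:
  shows zeta_conv_series: "Re s > 1 \<Longrightarrow> zeta s = zeta_series s"
    and zeta_0: "zeta 0 = - 1 / 2"
proof -
  obtain \<phi> where \<phi>: "\<phi> holomorphic_on UNIV" "\<And>s. Re s > 1 \<Longrightarrow> \<phi> s = (s - 1) * zeta_series s" "\<phi> 0 = 1 / 2"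
    using zeta_continuation by blast
  define f where "f s = (if s = 1 then 0 else \<phi> s / (s - 1))" for s
  let ?P = "\<lambda>f. f holomorphic_on - {1} \<and> f 1 = 0 \<and>
             (\<forall>s. Re s > 1 \<longrightarrow> (\<lambda>n. 1 / of_nat (Suc n) powr s) sums f s)"
  have "(\<lambda>s. \<phi> s / (s - 1)) holomorphic_on - {1}"
    using holomorphic_on_subset[OF \<phi>(1)] by (intro holomorphic_intros) auto
  moreover have "f holomorphic_on - {1} \<longleftrightarrow> (\<lambda>s. \<phi> s / (s - 1)) holomorphic_on - {1}"
    by (intro holomorphic_cong) (auto simp: f_def)
  ultimately have hol: "f holomorphic_on - {1}" by simp
  have f: "f s = zeta_series s" if "Re s > 1" for s
    using that \<phi>(2) by (auto simp: f_def)
  have P: "?P f"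
    using hol f summable_sums[OF summable_zeta_series] by (auto simp: f_def[of 1] zeta_series_def)
  have "g = f" if "?P g" for g
  proof
    fix s show "g s = f s"
    proof (cases "s = 1")
      case False
      show ?thesis
      proof (rule analytic_continuation_open[of "{s. Re s > 1}" "- {1}" g f])
        show "{s. Re s > 1} \<noteq> {}" by (auto intro!: exI[of _ "2::complex"])
        show "connected (- {1::complex})" by (intro connected_punctured_universe) auto
        show "g z = f z" if "z \<in> {s. Re s > 1}" for z
          using that P \<open>?P g\<close> by (auto intro: sums_unique2)
      qed (use that False hol in \<open>auto simp: open_halfspace_Re_gt\<close>)
    qed (use that P in auto)
  qed
  hence eq: "zeta = f" unfolding zeta_def by (intro the_equality P)
  show "Re s > 1 \<Longrightarrow> zeta s = zeta_series s" "zeta 0 = - 1 / 2"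
    using f \<phi>(3) unfolding eq by (simp_all add: f_def)
qed

subsection \<open>The convolution identity for even zeta values\<close>

lemma one_plus_not_nonpos_Ints:
  fixes w :: complex
  assumes "norm w < 1"
  shows "1 + w \<notin> \<int>\<^sub>\<le>\<^sub>0"
proof
  assume "1 + w \<in> \<int>\<^sub>\<le>\<^sub>0"
  then obtain n where "1 + w = - of_nat n" by (elim nonpos_Ints_cases')
  hence "w = - of_nat (Suc n)" by (simp add: algebra_simps eq_neg_iff_add_eq_0)
  hence "norm w = real (Suc n)" by (simp only: norm_minus_cancel norm_of_nat)
  thus False using assms by simp
qed

text \<open>Differentiate sin (\<pi> w) = \<pi> w rGamma(1 + w) rGamma(1 - w). The result is kept
  free of division by the sine, so it also holds at z = 0; \<open>norm z < 1\<close> keeps 1 + z and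
  1 - z off the poles of Digamma.\<close>

lemma Digamma_reflection_sin_cos:
  fixes z :: complex
  assumes "norm z < 1"
  shows "(z * (Digamma (1 + z) - Digamma (1 - z)) - 1) * sin (of_real pi * z) =
         - of_real pi * z * cos (of_real pi * z)"
proof -
  have 1: "1 + z \<notin> \<int>\<^sub>\<le>\<^sub>0" "1 - z \<notin> \<int>\<^sub>\<le>\<^sub>0"
    using one_plus_not_nonpos_Ints[of z] one_plus_not_nonpos_Ints[of "-z"] assms by simp_all
  have sin_eq: "sin (of_real pi * w) = of_real pi * w * rGamma (1 + w) * rGamma (1 - w)" for w :: complex
    using rGamma_reflection_complex[of w] rGamma_plus1[of w, symmetric] by (simp add: field_simps)
  have "((\<lambda>w. sin (of_real pi * w)) has_field_derivative of_real pi * cos (of_real pi * z)) (at z)"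
    by (auto intro!: derivative_eq_intros)
  moreover have "((\<lambda>w. of_real pi * w * rGamma (1 + w) * rGamma (1 - w)) has_field_derivative
     of_real pi * rGamma (1 + z) * rGamma (1 - z) +
     of_real pi * z * rGamma (1 + z) * rGamma (1 - z) * (Digamma (1 - z) - Digamma (1 + z))) (at z)"
    using 1 by (auto intro!: derivative_eq_intros simp: algebra_simps)
  ultimately have "of_real pi * cos (of_real pi * z) =
     of_real pi * rGamma (1 + z) * rGamma (1 - z) +
     of_real pi * z * rGamma (1 + z) * rGamma (1 - z) * (Digamma (1 - z) - Digamma (1 + z))"
    unfolding sin_eq by (rule DERIV_unique)
  from arg_cong[OF this, of "\<lambda>x. z * x"]
  have "z * (of_real pi * cos (of_real pi * z)) = sin (of_real pi * z) * (1 - z * (Digamma (1 + z) - Digamma (1 - z)))"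
    unfolding sin_eq by (simp add: algebra_simps)
  thus ?thesis by (simp add: algebra_simps)
qed

text \<open>The generating function f written in z with x = z^2, so that the cotangent identity
  involves no square root.\<close>

definition zeta_even_fps :: "complex fps" where
  "zeta_even_fps = Abs_fps (\<lambda>m. if m = 0 then -1/2 else if even m
     then (\<Sum>k. 1 / of_nat (Suc k) ^ m) else 0)"

text \<open>This is where zeta values enter: for m > 0 the coefficient is (-1)^(m+1) \<zeta>(m +
  1).\<close>

lemma has_fps_expansion_Digamma_1_plus:
  "(\<lambda>z::complex. Digamma (1 + z)) has_fps_expansion Abs_fps (\<lambda>m. Polygamma m 1 / fact m)"
proof -
  have "(\<lambda>z::complex. Digamma (1 + z)) holomorphic_on ball 0 1"
    by (intro holomorphic_on_compose_gen[of "\<lambda>z. 1 + z" _ Digamma "- \<int>\<^sub>\<le>\<^sub>0", unfolded o_def])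
       (rule holomorphic_intros image_subsetI | simp add: one_plus_not_nonpos_Ints)+
  hence "(\<lambda>z::complex. Digamma (1 + z)) has_fps_expansion fps_expansion (\<lambda>z. Digamma (1 + z)) 0"
    by (intro has_fps_expansion_fps_expansion) auto
  also have "fps_expansion (\<lambda>z::complex. Digamma (1 + z)) 0 = Abs_fps (\<lambda>m. Polygamma m 1 / fact m)"
  proof -
    have "(deriv ^^ m) (\<lambda>z::complex. Digamma (1 + z)) 0 = Polygamma m 1" for m
    proof -
      have "(deriv ^^ m) (\<lambda>z::complex. Digamma (1 + z)) 0 = (deriv ^^ m) Digamma 1"
        by (subst higher_deriv_shift_0[of _ _ 1]) (simp add: o_def)
      thus ?thesis by (simp add: higher_deriv_Polygamma)
    qed
    thus ?thesis by (simp add: fps_expansion_def)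
  qed
  finally show ?thesis .
qed

text \<open>The generating function of the \<open>\<zeta>(2k)\<close> is \<open>-(\<pi> z / 2) cot (\<pi> z)\<close>.\<close>

lemma zeta_even_fps_trig:
  "fps_const 2 * zeta_even_fps * fps_sin (of_real pi) = - (fps_const (of_real pi) * fps_X * fps_cos (of_real pi))"
proof -
  let ?P = "Abs_fps (\<lambda>m. Polygamma m 1 / fact m :: complex)"
  have 1: "((\<lambda>z::complex. Digamma (1 + z)) \<circ> (\<lambda>z. -z)) has_fps_expansion fps_compose ?P (- fps_X)"
    by (intro has_fps_expansion_compose has_fps_expansion_Digamma_1_plus fps_expansion_intros) auto
  have 2: "fps_compose ?P (- fps_X) = Abs_fps (\<lambda>m. (-1) ^ m * Polygamma m 1 / fact m)"
    by (simp add: fps_eq_iff fps_compose_uminus')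
  \<comment> \<open>The reflected series cancels the even m and doubles the odd ones;
    \<open>fps_X\<close> moves \<zeta>(m + 1) to index m + 1, and -1 is twice the constant term
    -1/2.\<close>
  have 3: "fps_X * (?P - Abs_fps (\<lambda>m. (-1) ^ m * Polygamma m 1 / fact m)) - 1 = fps_const 2 * zeta_even_fps"
  proof (rule fps_ext)
    fix n :: nat
    show "fps_nth (fps_X * (?P - Abs_fps (\<lambda>m. (-1) ^ m * Polygamma m 1 / fact m)) - 1) n =
          fps_nth (fps_const 2 * zeta_even_fps) n"
    proof (cases n)
      case (Suc m)
      thus ?thesis by (auto simp: zeta_even_fps_def Polygamma_def field_simps)
    qed (auto simp: zeta_even_fps_def)
  qed
  have A: "(\<lambda>z::complex. (z * (Digamma (1 + z) - Digamma (1 - z)) - 1) * sin (of_real pi * z))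
     has_fps_expansion fps_const 2 * zeta_even_fps * fps_sin (of_real pi)"
    using 1 unfolding 2 3[symmetric] o_def
    by (intro fps_expansion_intros has_fps_expansion_Digamma_1_plus) simp_all
  have "(\<lambda>z::complex. - of_real pi * z * cos (of_real pi * z))
     has_fps_expansion fps_const (- of_real pi) * fps_X * fps_cos (of_real pi)"
    by (intro fps_expansion_intros)
  moreover have "eventually (\<lambda>z::complex. (z * (Digamma (1 + z) - Digamma (1 - z)) - 1) * sin (of_real pi * z) =
         - of_real pi * z * cos (of_real pi * z)) (nhds 0)"
  proof -
    have "eventually (\<lambda>z::complex. z \<in> ball 0 1) (nhds 0)"
      by (intro eventually_nhds_in_open) auto
    thus ?thesis by eventually_elim (intro Digamma_reflection_sin_cos, simp)
  qed
  ultimately have "(\<lambda>z::complex. (z * (Digamma (1 + z) - Digamma (1 - z)) - 1) * sin (of_real pi * z))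
     has_fps_expansion fps_const (- of_real pi) * fps_X * fps_cos (of_real pi)"
    by (subst has_fps_expansion_cong) auto
  from fps_expansion_unique_complex[OF A this] show ?thesis by (simp flip: fps_const_neg)
qed

text \<open>Differentiate the trigonometric identity, multiply by X, eliminate the cosine through
  the same identity and cancel the nonzero sine series.\<close>

lemma zeta_even_fps_ode:
  "fps_X * fps_deriv zeta_even_fps =
     fps_const 2 * zeta_even_fps ^ 2 + zeta_even_fps + fps_const (of_real pi ^ 2 / 2) * fps_X ^ 2"
proof -
  define S C p H where "S = fps_sin (of_real pi :: complex)" and "C = fps_cos (of_real pi :: complex)"
    and "p = fps_const (of_real pi :: complex)" and "H = zeta_even_fps"
  have trig: "2 * H * S = - (p * fps_X * C)"
    using zeta_even_fps_trig unfolding S_def C_def p_def H_def by (simp add: numeral_fps_const)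
  have S': "fps_deriv S = p * C" and C': "fps_deriv C = - p * S" and "fps_deriv p = 0"
    by (simp_all add: S_def C_def p_def fps_sin_deriv fps_cos_deriv)
  have "S \<noteq> 0"
  proof
    assume "S = 0"
    hence "fps_nth S 1 = 0" by simp
    thus False by (simp add: S_def fps_sin_def)
  qed
  have "fps_deriv (2 * H * S) = fps_deriv (- (p * fps_X * C))" by (simp only: trig)
  hence 1: "2 * fps_deriv H * S + 2 * H * (p * C) = - (p * C) + p * p * fps_X * S"
    by (simp add: S' C' \<open>fps_deriv p = 0\<close> algebra_simps)
  have "(2 * (fps_X * fps_deriv H)) * S = fps_X * (2 * fps_deriv H * S + 2 * H * (p * C)) - 2 * H * (p * fps_X * C)"
    by (simp add: algebra_simps)
  also have "\<dots> = - (p * fps_X * C) + p * p * fps_X ^ 2 * S + 2 * H * (- (p * fps_X * C))"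
    unfolding 1 by (simp add: algebra_simps power2_eq_square)
  also have "\<dots> = (2 * H + p * p * fps_X ^ 2 + 4 * H ^ 2) * S"
    unfolding trig[symmetric] by (simp add: algebra_simps power2_eq_square)
  finally have "2 * (fps_X * fps_deriv H) = 2 * H + p * p * fps_X ^ 2 + 4 * H ^ 2"
    using \<open>S \<noteq> 0\<close> by simp
  also have "(4 :: complex fps) = 2 * fps_const 2" by (simp add: numeral_fps_const)
  also have "p * p = 2 * fps_const (of_real pi ^ 2 / 2)"
    by (simp add: p_def power2_eq_square numeral_fps_const)
  finally have "2 * (fps_X * fps_deriv H) = 2 * (fps_const 2 * H ^ 2 + H + fps_const (of_real pi ^ 2 / 2) * fps_X ^ 2)"
    by (simp add: algebra_simps)
  thus ?thesis unfolding H_def by (simp only: mult_cancel_left) auto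
qed

text \<open>Euler's recurrence, read off from the coefficient of X^(2n) in the differential
  equation. The X^2 term is absent for n \<ge> 2, and the boundary terms of the square contribute
  -Z(n).\<close>

lemma even_zeta_convolution:
  fixes Z :: "nat \<Rightarrow> complex"
  assumes Z: "\<And>k. k \<ge> 1 \<Longrightarrow> Z k = (\<Sum>m. 1 / of_nat (Suc m) ^ (2 * k))" and n: "n \<ge> 2"
  shows "(of_nat n + 1 / 2) * Z n = (\<Sum>j\<in>{1..<n}. Z j * Z (n - j))"
proof -
  let ?H = zeta_even_fps
  have nth: "fps_nth ?H (2 * k) = (if k = 0 then -1/2 else Z k)" for k
    using Z[of k] by (auto simp: zeta_even_fps_def)
  have odd: "fps_nth ?H k = 0" if "odd k" for k
    using that by (auto simp: zeta_even_fps_def elim: oddE)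
  have "fps_nth (?H ^ 2) (2 * n) = (\<Sum>i=0..2*n. fps_nth ?H i * fps_nth ?H (2 * n - i))"
    by (simp add: power2_eq_square fps_mult_nth)
  also have "\<dots> = (\<Sum>i\<in>(\<lambda>j. 2 * j) ` {0..n}. fps_nth ?H i * fps_nth ?H (2 * n - i))"
  proof (rule sum.mono_neutral_right)
    show "\<forall>i\<in>{0..2*n} - (\<lambda>j. 2 * j) ` {0..n}. fps_nth ?H i * fps_nth ?H (2 * n - i) = 0"
    proof
      fix i assume i: "i \<in> {0..2*n} - (\<lambda>j. 2 * j) ` {0..n}"
      have "odd i"
      proof
        assume "even i"
        then obtain j where "i = 2 * j" by (elim evenE)
        thus False using i by auto
      qed
      thus "fps_nth ?H i * fps_nth ?H (2 * n - i) = 0" by (simp add: odd)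
    qed
  qed auto
  also have "\<dots> = (\<Sum>j=0..n. fps_nth ?H (2 * j) * fps_nth ?H (2 * (n - j)))"
    by (subst sum.reindex) (auto simp: inj_on_def diff_mult_distrib2)
  also have "{0..n} = insert 0 (insert n {1..<n})" using n by auto
  also have "(\<Sum>j\<in>insert 0 (insert n {1..<n}). fps_nth ?H (2 * j) * fps_nth ?H (2 * (n - j)))
      = (\<Sum>j\<in>{1..<n}. Z j * Z (n - j)) - Z n"
    using n by (simp add: nth)
  finally have sq: "fps_nth (?H ^ 2) (2 * n) = (\<Sum>j\<in>{1..<n}. Z j * Z (n - j)) - Z n" .
  have "fps_nth (fps_X * fps_deriv ?H) (2 * n) = 2 * of_nat n * Z n"
    using n nth[of n] by (cases n) (auto simp: algebra_simps)
  moreover have "fps_nth (fps_const (of_real pi ^ 2 / 2 :: complex) * fps_X ^ 2) (2 * n) = 0"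
    using n by simp
  ultimately have "2 * of_nat n * Z n = 2 * ((\<Sum>j\<in>{1..<n}. Z j * Z (n - j)) - Z n) + Z n"
    using zeta_even_fps_ode[THEN arg_cong, of "\<lambda>F. fps_nth F (2 * n)"] n nth[of n] sq by simp
  thus ?thesis by (simp add: field_simps)
qed

subsection \<open>Weighted polynomials in the rational generating function\<close>

text \<open>\<open>zq n\<close> is the rational number \<open>\<zeta>(2n) / \<zeta>(2)\<^sup>n\<close>.\<close>

fun zq :: "nat \<Rightarrow> rat" where
  "zq n = (if n = 0 then -1/2 else if n = 1 then 1
           else (\<Sum>j\<in>{1..<n}. zq j * zq (n - j)) / (of_nat n + 1/2))"

declare zq.simps [simp del]

lemma zq_0 [simp]: "zq 0 = -1/2" and zq_1 [simp]: "zq (Suc 0) = 1"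
  by (simp_all add: zq.simps)

lemma zq_rec:
  assumes "n \<ge> 2"
  shows "(of_nat n + 1/2) * zq n = (\<Sum>j\<in>{1..<n}. zq j * zq (n - j))"
proof -
  have "(of_nat n + 1/2 :: rat) > 0" by (simp add: add_pos_pos)
  thus ?thesis using assms by (subst zq.simps) (simp add: field_simps)
qed

text \<open>Positivity passes through the recursion; it later permits division by
  \<open>zq i\<close>.\<close>

lemma zq_pos: "n > 0 \<Longrightarrow> zq n > 0"
proof (induction n rule: less_induct)
  case (less n)
  show ?case
  proof (cases "n = 1")
    case False
    with less.prems have n: "n \<ge> 2" by simp
    have "(\<Sum>j\<in>{1..<n}. zq j * zq (n - j)) > 0"
      using n less.IH by (intro sum_pos) auto
    with zq_rec[OF n] have "(of_nat n + 1/2) * zq n > 0" by simp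
    thus ?thesis by (simp add: zero_less_mult_iff)
  qed auto
qed

lemma zq_nonzero: "zq n \<noteq> 0"
  using zq_pos[of n] by (cases "n = 0") auto

section \<open>The rational generating function and the operator x d/dx\<close>

definition zq_fps :: "rat fps" where "zq_fps = Abs_fps zq"

text \<open>The series u of the opening comment with \<zeta>(2) scaled to 1. The factor 3/2 is
  forced by the coefficient of x in \<open>euler_op_zq_fps\<close>.\<close>

definition zq_var :: "rat fps" where "zq_var = fps_const (3/2) * fps_X"

definition euler_op :: "rat fps \<Rightarrow> rat fps" where "euler_op G = fps_X * fps_deriv G"

lemma zq_fps_nth [simp]: "fps_nth zq_fps n = zq n"
  by (simp add: zq_fps_def)

lemma euler_op_nth [simp]: "fps_nth (euler_op G) n = of_nat n * fps_nth G n"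
  by (cases n) (simp_all add: euler_op_def)

lemma euler_op_pow_nth [simp]: "fps_nth ((euler_op ^^ a) G) n = of_nat n ^ a * fps_nth G n"
  by (induction a) (auto simp: mult_ac)

lemma euler_op_add: "euler_op (F + G) = euler_op F + euler_op G"
  by (simp add: euler_op_def algebra_simps)

lemma euler_op_diff: "euler_op (F - G) = euler_op F - euler_op G"
  by (simp add: euler_op_def algebra_simps)

lemma euler_op_const_mult: "euler_op (fps_const c * G) = fps_const c * euler_op G"
  by (simp add: euler_op_def algebra_simps)

lemma euler_op_mult: "euler_op (F * G) = euler_op F * G + F * euler_op G"
  by (simp add: euler_op_def algebra_simps)

lemma euler_op_power: "euler_op (F ^ m) = fps_const (of_nat m) * F ^ (m - 1) * euler_op F"
  by (simp add: euler_op_def fps_deriv_power algebra_simps)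

lemma euler_op_zq_var: "euler_op zq_var = zq_var"
  by (simp add: euler_op_def zq_var_def algebra_simps)

lemma zq_var_power_nth: "fps_nth (zq_var ^ i * G) n = (if n < i then 0 else (3/2) ^ i * fps_nth G (n - i))"
  by (simp add: zq_var_def power_mult_distrib fps_const_power mult.assoc fps_X_power_mult_nth)

lemma fps_mult_nth_split:
  assumes "n \<ge> 1"
  shows "fps_nth (F * G) n = (\<Sum>j\<in>{1..<n}. fps_nth F j * fps_nth G (n - j))
           + fps_nth F 0 * fps_nth G n + fps_nth F n * fps_nth G 0"
proof -
  have "{0..n} = insert 0 (insert n {1..<n})" using assms by auto
  thus ?thesis using assms by (simp add: fps_mult_nth algebra_simps)
qed

text \<open>For n \<ge> 2 the coefficients agree by \<open>zq_rec\<close>, with the boundary terms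
  of the square giving -zq(n).\<close>

lemma euler_op_zq_fps: "euler_op zq_fps = zq_fps ^ 2 + fps_const (1/2) * zq_fps + zq_var"
proof (rule fps_ext)
  fix n :: nat
  consider "n = 0" | "n = 1" | "n \<ge> 2" by linarith
  thus "fps_nth (euler_op zq_fps) n = fps_nth (zq_fps ^ 2 + fps_const (1/2) * zq_fps + zq_var) n"
  proof cases
    case 3
    have "fps_nth zq_var n = 0" using 3 by (simp add: zq_var_def)
    with 3 zq_rec[OF 3] show ?thesis
      by (simp add: power2_eq_square fps_mult_nth_split algebra_simps)
  qed (simp_all add: power2_eq_square fps_mult_nth zq_var_def)
qed

text \<open>
  Here \<open>zq_fps\<close> has weight 1 and \<open>zq_var\<close> weight 2. Weight alone is not enough for the induction:
  the term \<open>zq_var\<close> in the differential equation has full weight 2, so \<open>p\<close> separately bounds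
  the degree in \<open>zq_fps\<close>.
\<close>

inductive wspan :: "nat \<Rightarrow> nat \<Rightarrow> rat fps \<Rightarrow> bool" for w p where
  zero: "wspan w p 0"
| step: "wspan w p G \<Longrightarrow> m + 2 * i \<le> w \<Longrightarrow> m \<le> p \<Longrightarrow>
           wspan w p (G + fps_const q * (zq_fps ^ m * zq_var ^ i))"

lemma wspan_mono: "wspan w p G \<Longrightarrow> w \<le> w' \<Longrightarrow> p \<le> p' \<Longrightarrow> wspan w' p' G"
  by (induction rule: wspan.induct) (auto intro: wspan.intros)

lemma wspan_monomial: "m + 2 * i \<le> w \<Longrightarrow> m \<le> p \<Longrightarrow> wspan w p (fps_const q * (zq_fps ^ m * zq_var ^ i))"
  using wspan.step[OF wspan.zero, of m i w p q] by simp

lemma wspan_add: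
  assumes "wspan w p F" "wspan w p G"
  shows "wspan w p (F + G)"
  using assms(2,1) by induction (auto simp: add.assoc[symmetric] intro: wspan.intros)

lemma wspan_scale:
  assumes "wspan w p F"
  shows "wspan w p (fps_const c * F)"
  using assms
proof induction
  case (step G m i q)
  have "fps_const c * (G + fps_const q * (zq_fps ^ m * zq_var ^ i)) =
        fps_const c * G + fps_const (c * q) * (zq_fps ^ m * zq_var ^ i)"
    by (simp add: algebra_simps flip: fps_const_mult)
  with step show ?case by (simp add: wspan.step)
qed (auto intro: wspan.intros)

lemma wspan_diff:
  assumes "wspan w p F" "wspan w p G"
  shows "wspan w p (F - G)"
proof -
  have "F + fps_const (-1) * G = F - G"
    by (simp flip: fps_const_neg)
  thus ?thesis using wspan_add[OF assms(1) wspan_scale[OF assms(2), of "-1"]] by simp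
qed

lemma wspan_sum: "(\<And>x. x \<in> A \<Longrightarrow> wspan w p (f x)) \<Longrightarrow> wspan w p (sum f A)"
  by (induction A rule: infinite_finite_induct) (auto intro: wspan.zero wspan_add)

lemma wspan_mult_monomial:
  assumes "wspan w p F"
  shows "wspan (w + (m + 2 * i)) (p + m) (F * (zq_fps ^ m * zq_var ^ i))"
  using assms
proof induction
  case (step G k l q)
  have "(G + fps_const q * (zq_fps ^ k * zq_var ^ l)) * (zq_fps ^ m * zq_var ^ i) =
        G * (zq_fps ^ m * zq_var ^ i) + fps_const q * (zq_fps ^ (k + m) * zq_var ^ (l + i))"
    by (simp add: algebra_simps power_add)
  with step show ?case by (simp add: wspan.step)
qed (auto intro: wspan.intros)

lemma wspan_mult:
  assumes "wspan w p F" "wspan w' p' G"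
  shows "wspan (w + w') (p + p') (F * G)"
  using assms(2)
proof induction
  case (step G k l q)
  have "wspan (w + w') (p + p') (F * (zq_fps ^ k * zq_var ^ l))"
    using wspan_mono[OF wspan_mult_monomial[OF assms(1), of k l]] step by auto
  from wspan_add[OF step.IH wspan_scale[OF this, of q]] show ?case
    by (simp add: algebra_simps)
qed (auto intro: wspan.intros)

text \<open>Product rule with \<theta> f = f^2 + f/2 + u and \<theta> u = u. At m = 0 the truncated
  exponent \<open>m - 1\<close> is harmless, as its coefficient is 0.\<close>

lemma euler_op_monomial:
  "euler_op (zq_fps ^ m * zq_var ^ i) = fps_const (of_nat m) * (zq_fps ^ (m + 1) * zq_var ^ i)
     + (fps_const (of_nat m / 2 + of_nat i) * (zq_fps ^ m * zq_var ^ i)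
     + fps_const (of_nat m) * (zq_fps ^ (m - 1) * zq_var ^ (i + 1)))"
proof -
  have 1: "fps_const (of_nat i) * zq_var ^ (i - 1) * zq_var = fps_const (of_nat i) * zq_var ^ i"
    by (cases i) (auto simp: mult_ac)
  have 2: "fps_const (of_nat m) * zq_fps ^ (m - 1) * zq_fps = fps_const (of_nat m) * zq_fps ^ m"
    by (cases m) (auto simp: mult_ac)
  have "euler_op (zq_fps ^ m * zq_var ^ i) = fps_const (of_nat m) * zq_fps ^ (m - 1) * zq_fps * (zq_fps * zq_var ^ i)
      + fps_const (1/2) * (fps_const (of_nat m) * zq_fps ^ (m - 1) * zq_fps) * zq_var ^ i
      + fps_const (of_nat m) * (zq_fps ^ (m - 1) * zq_var ^ (i + 1))
      + zq_fps ^ m * (fps_const (of_nat i) * zq_var ^ (i - 1) * zq_var)"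
    by (simp add: euler_op_mult euler_op_power euler_op_zq_fps euler_op_zq_var algebra_simps power2_eq_square)
  also have "\<dots> = fps_const (of_nat m) * (zq_fps ^ (m + 1) * zq_var ^ i)
     + ((fps_const (1/2) * fps_const (of_nat m) + fps_const (of_nat i)) * (zq_fps ^ m * zq_var ^ i)
     + fps_const (of_nat m) * (zq_fps ^ (m - 1) * zq_var ^ (i + 1)))"
    unfolding 1 2 by (simp add: algebra_simps del: fps_const_mult)
  also have "fps_const (1/2) * fps_const (of_nat m) + fps_const (of_nat i) =
             (fps_const (of_nat m / 2 + of_nat i) :: rat fps)"
    by simp
  finally show ?thesis .
qed

lemma wspan_euler_op:
  assumes "wspan w p F"
  shows "wspan (w + 1) (p + 1) (euler_op F)"
  using assms
proof induction
  case (step G m i q)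
  \<comment> \<open>For m > 0 the weight is (m - 1) + 2(i + 1) = m + 2i + 1; for m = 0 this count
    fails, but the term is 0.\<close>
  have "wspan (w + 1) (p + 1) (fps_const (of_nat m) * (zq_fps ^ (m - 1) * zq_var ^ (i + 1)))"
    using step by (cases "m = 0") (simp add: wspan.zero, intro wspan_monomial, auto)
  hence "wspan (w + 1) (p + 1) (euler_op (zq_fps ^ m * zq_var ^ i))"
    unfolding euler_op_monomial by (intro wspan_add) (use step.hyps in \<open>simp_all add: wspan_monomial del: power_Suc\<close>)
  thus ?case using step.IH by (simp add: euler_op_add euler_op_const_mult wspan_add wspan_scale)
qed (auto simp: euler_op_def intro: wspan.intros)

text \<open>One more \<theta> turns a! f^(a+1) into (a+1)! f^(a+2) plus terms of weight at most a +
  2 and degree at most a + 1 in f.\<close>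

lemma wspan_euler_op_pow_lead:
  "wspan (a + 1) a ((euler_op ^^ a) zq_fps - fps_const (fact a) * zq_fps ^ (a + 1))"
proof (induction a)
  case (Suc a)
  have "wspan (a + 2) (a + 1) (fps_const (of_nat (a+1)) * (zq_fps ^ a * zq_var ^ 1))"
    by (intro wspan_monomial) auto
  moreover have "wspan (a + 2) (a + 1) (fps_const (of_nat (a+1) / 2) * (zq_fps ^ (a+1) * zq_var ^ 0))"
    by (intro wspan_monomial) auto
  ultimately have 1: "wspan (a + 2) (a + 1)
     (fps_const (fact a) * (fps_const (of_nat (a+1) / 2) * (zq_fps ^ (a+1) * zq_var ^ 0)
       + fps_const (of_nat (a+1)) * (zq_fps ^ a * zq_var ^ 1)))"
    by (intro wspan_scale[of _ _ "_ + _"] wspan_add)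
  have 2: "(euler_op ^^ Suc a) zq_fps - fps_const (fact (Suc a)) * zq_fps ^ (Suc a + 1) =
    euler_op ((euler_op ^^ a) zq_fps - fps_const (fact a) * zq_fps ^ (a + 1)) +
    fps_const (fact a) * (fps_const (of_nat (a+1) / 2) * (zq_fps ^ (a+1) * zq_var ^ 0)
       + fps_const (of_nat (a+1)) * (zq_fps ^ a * zq_var ^ 1))"
    using euler_op_monomial[of "a+1" 0]
    by (simp only: euler_op_diff euler_op_const_mult funpow.simps o_apply fact_Suc mult_1_right power_0
          flip: fps_const_mult) (simp add: algebra_simps)
  show ?case unfolding 2
    using wspan_add[OF wspan_euler_op[OF Suc.IH] ] 1 by simp
qed (auto intro: wspan.zero)

lemma wspan_euler_op_pow: "wspan (a + 1) (a + 1) ((euler_op ^^ a) zq_fps)"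
proof -
  have "wspan (a + 1) (a + 1) (fps_const (fact a) * (zq_fps ^ (a + 1) * zq_var ^ 0))"
    by (intro wspan_monomial) auto
  from wspan_add[OF wspan_mono[OF wspan_euler_op_pow_lead[of a]] this] show ?thesis by simp
qed

section \<open>Reduction to the products \<open>zq k * zq (n - k)\<close>\<close>

text \<open>At w = d + 2 this is the shape of the theorem's right side divided by \<zeta>(2)^n.
  Requiring \<open>n \<ge> 1\<close> as well excludes the constant term when w = 0.\<close>

definition reducible_at :: "nat \<Rightarrow> rat fps \<Rightarrow> bool" where
  "reducible_at w G \<longleftrightarrow> (\<exists>K :: nat \<Rightarrow> rat poly. (\<forall>k. degree (K k) \<le> w - 1) \<and>
     (\<forall>n\<ge>1. n \<ge> w \<longrightarrow> fps_nth G n =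
        (\<Sum>k = 0..(w - 1) div 2. poly (K k) (of_nat n) * zq k * zq (n - k))))"

lemma reducible_at_add:
  assumes "reducible_at w F" "reducible_at w G"
  shows "reducible_at w (F + G)"
proof -
  obtain K L where "\<forall>k. degree (K k) \<le> w - 1"
     "\<forall>n\<ge>1. n \<ge> w \<longrightarrow> fps_nth F n = (\<Sum>k = 0..(w - 1) div 2. poly (K k) (of_nat n) * zq k * zq (n - k))"
     "\<forall>k. degree (L k) \<le> w - 1"
     "\<forall>n\<ge>1. n \<ge> w \<longrightarrow> fps_nth G n = (\<Sum>k = 0..(w - 1) div 2. poly (L k) (of_nat n) * zq k * zq (n - k))"
    using assms unfolding reducible_at_def by blast
  thus ?thesis unfolding reducible_at_def
    by (intro exI[of _ "\<lambda>k. K k + L k"])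
       (auto simp: degree_add_le sum.distrib[symmetric] algebra_simps intro!: sum.cong)
qed

lemma reducible_at_scale:
  assumes "reducible_at w F"
  shows "reducible_at w (fps_const c * F)"
proof -
  obtain K where "\<forall>k. degree (K k) \<le> w - 1"
     "\<forall>n\<ge>1. n \<ge> w \<longrightarrow> fps_nth F n = (\<Sum>k = 0..(w - 1) div 2. poly (K k) (of_nat n) * zq k * zq (n - k))"
    using assms unfolding reducible_at_def by blast
  thus ?thesis unfolding reducible_at_def
    by (intro exI[of _ "\<lambda>k. smult c (K k)"])
       (auto simp: sum_distrib_left algebra_simps intro!: sum.cong order.trans[OF degree_smult_le])
qed

lemma reducible_at_vanishing:
  assumes "\<And>n. n \<ge> 1 \<Longrightarrow> n \<ge> w \<Longrightarrow> fps_nth F n = 0"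
  shows "reducible_at w F"
  unfolding reducible_at_def using assms by (intro exI[of _ "\<lambda>_. 0"]) auto

text \<open>The coefficient of x^n is (3/2)^i (n - i)^l zq(n - i), so only \<open>K i\<close> is
  nonzero, and it is divided by \<open>zq i\<close> to supply that factor. The hypothesis bounds
  both the degree l and the index i.\<close>

lemma reducible_at_var_euler_op_pow:
  assumes "l + 1 + 2 * i \<le> w"
  shows "reducible_at w (zq_var ^ i * (euler_op ^^ l) zq_fps)"
proof -
  define K where
    "K = (\<lambda>k. if k = i then smult ((3/2) ^ i / zq i) ([:- of_nat i, 1:] ^ l) else 0)"
  have "degree ([:- of_nat i, 1 :: rat:] ^ l) \<le> w - 1"
    using degree_power_le[of "[:- of_nat i, 1 :: rat:]" l] assms by simp
  hence deg: "degree (K k) \<le> w - 1" for k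
    unfolding K_def using order.trans[OF degree_smult_le] by auto
  have "(\<Sum>k = 0..(w - 1) div 2. poly (K k) (of_nat n) * zq k * zq (n - k)) =
        fps_nth (zq_var ^ i * (euler_op ^^ l) zq_fps) n" if n: "n \<ge> 1" "n \<ge> w" for n
  proof -
    have i: "i \<le> (w - 1) div 2" "i \<le> n" using assms n by auto
    have "(\<Sum>k = 0..(w - 1) div 2. poly (K k) (of_nat n) * zq k * zq (n - k)) =
          (\<Sum>k = 0..(w - 1) div 2.
             if k = i then (3/2) ^ i * (of_nat n - of_nat i) ^ l * zq (n - i) else 0)"
      by (intro sum.cong) (auto simp: K_def zq_nonzero)
    thus ?thesis using i by (simp add: zq_var_power_nth of_nat_diff)
  qed
  with deg show ?thesis unfolding reducible_at_def by (intro exI[of _ K]) auto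
qed

text \<open>Induction on the degree in f at fixed weight: f^(p+1) u^i is u^i \<theta>^p f / p! minus
  a multiple of \<open>?R\<close> u^i, and \<open>?R\<close> has degree at most p in f.\<close>

lemma wspan_reducible: "wspan w p F \<Longrightarrow> reducible_at w F"
proof (induction p arbitrary: F)
  case 0
  thus ?case
  proof induction
    case (step G m i q)
    \<comment> \<open>A pure power of u has only the coefficient at i, and n > i follows from n
      \<ge> 1 and n \<ge> w \<ge> 2i.\<close>
    have "reducible_at w (zq_var ^ i * 1)"
      using step.hyps by (intro reducible_at_vanishing) (simp only: zq_var_power_nth, auto)
    with step show ?case by (auto intro!: reducible_at_add reducible_at_scale)
  qed (auto intro: reducible_at_vanishing)
next
  case (Suc p)
  from Suc.prems show ?case
  proof induction
    case (step G m i q)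
    have "reducible_at w (zq_fps ^ m * zq_var ^ i)"
    proof (cases "m \<le> p")
      case True
      thus ?thesis using wspan_monomial[of m i w p 1] step Suc.IH by simp
    next
      case False
      with step have m: "m = p + 1" by simp
      let ?R = "(euler_op ^^ p) zq_fps - fps_const (fact p) * zq_fps ^ (p + 1)"
      have "wspan (p + 1 + (0 + 2 * i)) (p + 0) (?R * (zq_fps ^ 0 * zq_var ^ i))"
        by (intro wspan_mult_monomial wspan_euler_op_pow_lead)
      hence "wspan w p (?R * zq_var ^ i)"
        using step m by (auto elim!: wspan_mono)
      hence "reducible_at w (?R * zq_var ^ i)" by (rule Suc.IH)
      moreover have "reducible_at w (zq_var ^ i * (euler_op ^^ p) zq_fps)"
        using step m by (intro reducible_at_var_euler_op_pow) auto
      ultimately have "reducible_at w (fps_const (1 / fact p) * (zq_var ^ i * (euler_op ^^ p) zq_fps) +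
                         fps_const (- 1 / fact p) * (?R * zq_var ^ i))"
        by (intro reducible_at_add reducible_at_scale)
      also have "fps_const (1 / fact p) * (zq_var ^ i * (euler_op ^^ p) zq_fps) + fps_const (- 1 / fact p) * (?R * zq_var ^ i)
          = (fps_const (1 / fact p) + fps_const (- 1 / fact p)) * (zq_var ^ i * (euler_op ^^ p) zq_fps)
            + fps_const (1 / fact p) * fps_const (fact p) * (zq_fps ^ m * zq_var ^ i)"
        by (simp add: m algebra_simps del: fps_const_add fps_const_mult)
           (simp add: algebra_simps flip: fps_const_neg)
      also have "\<dots> = zq_fps ^ m * zq_var ^ i" by simp
      finally show ?thesis .
    qed
    thus ?case by (intro reducible_at_add reducible_at_scale step.IH)
  qed (auto intro: reducible_at_vanishing)
qed

section \<open>Convolutions weighted by a bivariate polynomial\<close>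

lemma coeff_le_total_degree:
  assumes "coeff (coeff F j) i \<noteq> 0"
  shows "i + j \<le> total_degree F"
proof -
  have "{i + j | i j. coeff (coeff F j) i \<noteq> 0} \<subseteq>
     (\<Union>j\<in>{..degree F}. (\<lambda>i. i + j) ` {..degree (coeff F j)})"
  proof safe
    fix i j assume *: "coeff (coeff F j) i \<noteq> 0"
    hence "coeff F j \<noteq> 0" by auto
    thus "i + j \<in> (\<Union>j\<in>{..degree F}. (\<lambda>i. i + j) ` {..degree (coeff F j)})"
      using * by (auto intro!: bexI[of _ j] imageI le_degree)
  qed
  hence "finite {i + j | i j. coeff (coeff F j) i \<noteq> 0}"
    by (rule finite_subset) auto
  thus ?thesis unfolding total_degree_def using assms by (intro Max_ge) auto
qed

lemma poly2_altdef:
  fixes F :: "'a::comm_semiring_1 poly poly"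
  shows "poly2 F x y = (\<Sum>l\<le>degree F. \<Sum>i\<le>degree (coeff F l). coeff (coeff F l) i * x ^ i * y ^ l)"
proof -
  have "poly2 F x y = poly (\<Sum>l\<le>degree F. coeff F l * [:y:] ^ l) x"
    unfolding poly2_def by (subst poly_altdef) simp
  also have "\<dots> = (\<Sum>l\<le>degree F. poly (coeff F l) x * y ^ l)"
    by (simp add: poly_sum poly_power)
  finally show ?thesis by (simp add: poly_altdef sum_distrib_right)
qed

text \<open>Each monomial x^i y^l of \<open>F\<close> corresponds to a series \<open>E i l\<close>
  of weight at most i + l + 2 \<le> d + 2, so \<open>wspan_reducible\<close> applies to their
  combination.\<close>

lemma zq_poly_sum:
  fixes F :: "rat poly poly"
  assumes "total_degree F = d"
  shows "\<exists>K :: nat \<Rightarrow> rat poly. (\<forall>k. degree (K k) \<le> d + 1) \<and>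
     (\<forall>n\<ge>d + 2. (\<Sum>j\<in>{1..<n}. poly2 F (of_nat j) (of_nat (n - j)) * zq j * zq (n - j)) =
        (\<Sum>k = 0..(d + 1) div 2. poly (K k) (of_nat n) * zq k * zq (n - k)))"
proof -
  \<comment> \<open>The subtractions remove the terms j = 0 and j = n of the Cauchy product. The
    constant term of \<theta>^i f is \<open>0 ^ i * zq 0\<close>, nonzero only for i = 0.\<close>
  define E where "E = (\<lambda>i l. (euler_op ^^ i) zq_fps * (euler_op ^^ l) zq_fps
     - fps_const (0 ^ i * zq 0) * (euler_op ^^ l) zq_fps - fps_const (0 ^ l * zq 0) * (euler_op ^^ i) zq_fps)"
  have wE: "wspan w w (E i l)" if "i + l + 2 \<le> w" for i l w
  proof -
    have "wspan (i + 1 + (l + 1)) (i + 1 + (l + 1)) ((euler_op ^^ i) zq_fps * (euler_op ^^ l) zq_fps)"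
      by (intro wspan_mult wspan_euler_op_pow)
    hence "wspan w w ((euler_op ^^ i) zq_fps * (euler_op ^^ l) zq_fps)" by (rule wspan_mono) (use that in auto)
    moreover have "wspan w w ((euler_op ^^ i) zq_fps)" by (rule wspan_mono[OF wspan_euler_op_pow]) (use that in auto)
    moreover have "wspan w w ((euler_op ^^ l) zq_fps)" by (rule wspan_mono[OF wspan_euler_op_pow]) (use that in auto)
    ultimately show ?thesis unfolding E_def by (intro wspan_diff wspan_scale)
  qed
  have E_nth: "fps_nth (E i l) n = (\<Sum>j\<in>{1..<n}. (of_nat j ^ i * of_nat (n - j) ^ l) * zq j * zq (n - j))"
    if "n \<ge> 1" for i l n
    unfolding E_def using that by (simp add: fps_mult_nth_split mult_ac)
  define G where "G = (\<Sum>l\<le>degree F. \<Sum>i\<le>degree (coeff F l). fps_const (coeff (coeff F l) i) * E i l)"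
  have "wspan (d + 2) (d + 2) (fps_const (coeff (coeff F l) i) * E i l)" for i l
  proof (cases "coeff (coeff F l) i = 0")
    case False
    from coeff_le_total_degree[OF this] assms show ?thesis by (intro wspan_scale wE) auto
  qed (auto intro: wspan.zero)
  hence "wspan (d + 2) (d + 2) G" unfolding G_def by (intro wspan_sum)
  hence "reducible_at (d + 2) G" by (rule wspan_reducible)
  then obtain K where K: "\<forall>k. degree (K k) \<le> d + 1"
    "\<forall>n\<ge>1. n \<ge> d + 2 \<longrightarrow> fps_nth G n = (\<Sum>k = 0..(d + 1) div 2. poly (K k) (of_nat n) * zq k * zq (n - k))"
    unfolding reducible_at_def by auto
  have "fps_nth G n = (\<Sum>j\<in>{1..<n}. poly2 F (of_nat j) (of_nat (n - j)) * zq j * zq (n - j))"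
    if "n \<ge> 1" for n
  proof -
    have "fps_nth G n = (\<Sum>l\<le>degree F. \<Sum>i\<le>degree (coeff F l). \<Sum>j\<in>{1..<n}.
       coeff (coeff F l) i * (of_nat j ^ i * of_nat (n - j) ^ l) * zq j * zq (n - j))"
      using that by (simp add: G_def fps_sum_nth E_nth sum_distrib_left mult_ac)
    also have "\<dots> = (\<Sum>j\<in>{1..<n}. \<Sum>l\<le>degree F. \<Sum>i\<le>degree (coeff F l).
       coeff (coeff F l) i * (of_nat j ^ i * of_nat (n - j) ^ l) * zq j * zq (n - j))"
      by (simp only: sum.swap[of _ "{1..<n}"])
    finally show ?thesis by (simp add: poly2_altdef sum_distrib_right mult.assoc)
  qed
  with K show ?thesis by (intro exI[of _ K]) auto
qed

subsection \<open>Weighted convolutions of zeta values\<close>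

lemma zeta_even:
  assumes "k \<ge> 1"
  shows "zeta (2 * of_nat k) = (\<Sum>m. 1 / of_nat (Suc m) ^ (2 * k))"
proof -
  have "of_nat (Suc m) powr (2 * of_nat k :: complex) = of_nat (Suc m) ^ (2 * k)" for m
    using powr_complexpow[of "of_nat (Suc m)" "2 * k"] by (simp del: of_nat_Suc powr_complexpow)
  thus ?thesis using assms by (subst zeta_conv_series) (simp_all add: zeta_series_def)
qed

text \<open>Both sides satisfy Euler's recurrence, as \<zeta>(2)^j \<zeta>(2)^(n-j) = \<zeta>(2)^n;
  the case n = 0 rests on \<zeta>(0) = -1/2.\<close>

lemma zeta_even_conv_zq: "zeta (2 * of_nat n) = of_rat (zq n) * zeta 2 ^ n"
proof (induction n rule: less_induct)
  case (less n)
  consider "n = 0" | "n = 1" | "n \<ge> 2" by linarith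
  thus ?case
  proof cases
    case 3
    have "(of_nat n + 1 / 2) * zeta (2 * of_nat n) =
          (\<Sum>j\<in>{1..<n}. zeta (2 * of_nat j) * zeta (2 * of_nat (n - j)))"
      using 3 by (intro even_zeta_convolution zeta_even)
    also have "\<dots> = (\<Sum>j\<in>{1..<n}. of_rat (zq j * zq (n - j)) * zeta 2 ^ n)"
    proof (intro sum.cong refl)
      fix j assume j: "j \<in> {1..<n}"
      hence "zeta 2 ^ n = zeta 2 ^ j * zeta 2 ^ (n - j)" by (simp flip: power_add)
      thus "zeta (2 * of_nat j) * zeta (2 * of_nat (n - j)) = of_rat (zq j * zq (n - j)) * zeta 2 ^ n"
        using less[of j] less[of "n - j"] j by (simp add: of_rat_mult)
    qed
    also have "\<dots> = of_rat (\<Sum>j\<in>{1..<n}. zq j * zq (n - j)) * zeta 2 ^ n"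
      by (simp add: of_rat_sum sum_distrib_right)
    also have "\<dots> = (of_nat n + 1 / 2) * (of_rat (zq n) * zeta 2 ^ n)"
      unfolding zq_rec[OF 3, symmetric] by (simp add: of_rat_mult of_rat_add of_rat_divide)
    finally have "(of_nat n + 1 / 2) * zeta (2 * of_nat n) = (of_nat n + 1 / 2) * (of_rat (zq n) * zeta 2 ^ n)" .
    moreover have "(of_nat n + 1 / 2 :: complex) \<noteq> 0"
      by (simp add: complex_eq_iff add_eq_0_iff)
    ultimately show ?thesis by (simp only: mult_cancel_left) simp
  qed (simp_all add: zeta_0 of_rat_divide of_rat_minus)
qed

theorem theorem2p7:
  fixes F :: "rat poly poly" and d :: nat
  assumes "total_degree F = d"
  shows "\<exists>K :: nat \<Rightarrow> rat poly.
           (\<forall>k \<le> (d + 1) div 2. degree (K k) \<le> d + 1) \<and>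
           (\<forall>n :: nat. n \<ge> d + 2 \<longrightarrow>
              (\<Sum>(j, k) \<in> {(j, k). j \<ge> 1 \<and> k \<ge> 1 \<and> j + k = n}.
                 of_rat (poly2 F (of_nat j) (of_nat k)) * zeta (2 * of_nat j) * zeta (2 * of_nat k))
              = (\<Sum>k = 0..(d + 1) div 2.
                   of_rat (poly (K k) (of_nat n)) * zeta (2 * of_nat k) * zeta (2 * of_nat n - 2 * of_nat k)))"
proof -
  obtain K :: "nat \<Rightarrow> rat poly" where K: "\<And>k. degree (K k) \<le> d + 1"
    "\<And>n. n \<ge> d + 2 \<Longrightarrow> (\<Sum>j\<in>{1..<n}. poly2 F (of_nat j) (of_nat (n - j)) * zq j * zq (n - j)) =
        (\<Sum>k = 0..(d + 1) div 2. poly (K k) (of_nat n) * zq k * zq (n - k))"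
    using zq_poly_sum[OF assms] by blast
  show ?thesis
  proof (intro exI[of _ K] conjI allI impI K(1))
    fix n :: nat assume n: "n \<ge> d + 2"
    \<comment> \<open>Every product on either side carries the same factor \<zeta>(2)^n, so the
      identity is the rational one multiplied by it.\<close>
    have split: "of_rat (q * zq j * zq (n - j)) * zeta 2 ^ n =
        of_rat q * zeta (2 * of_nat j) * zeta (2 * of_nat (n - j))" if "j \<le> n" for q j
      using that unfolding zeta_even_conv_zq
      by (simp add: of_rat_mult power_add[symmetric] mult_ac)
    have "(\<Sum>(j, k) \<in> {(j, k). j \<ge> 1 \<and> k \<ge> 1 \<and> j + k = n}.
             of_rat (poly2 F (of_nat j) (of_nat k)) * zeta (2 * of_nat j) * zeta (2 * of_nat k)) =
          (\<Sum>j\<in>{1..<n}. of_rat (poly2 F (of_nat j) (of_nat (n - j))) *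
             zeta (2 * of_nat j) * zeta (2 * of_nat (n - j)))"
      by (rule sum.reindex_bij_witness[of _ "\<lambda>j. (j, n - j)" fst]) auto
    also have "\<dots> = of_rat (\<Sum>j\<in>{1..<n}. poly2 F (of_nat j) (of_nat (n - j)) * zq j * zq (n - j)) * zeta 2 ^ n"
      unfolding of_rat_sum sum_distrib_right by (intro sum.cong refl split[symmetric]) auto
    also have "\<dots> = (\<Sum>k = 0..(d + 1) div 2. of_rat (poly (K k) (of_nat n)) *
                       zeta (2 * of_nat k) * zeta (2 * of_nat (n - k)))"
      unfolding K(2)[OF n] of_rat_sum sum_distrib_right using n by (intro sum.cong refl split) auto
    \<comment> \<open>Here k \<le> (d + 1) div 2 \<le> n, so the natural subtraction
      \<open>n - k\<close> is not truncated.\<close>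
    also have "\<dots> = (\<Sum>k = 0..(d + 1) div 2. of_rat (poly (K k) (of_nat n)) *
                       zeta (2 * of_nat k) * zeta (2 * of_nat n - 2 * of_nat k))"
      using n by (intro sum.cong refl) (auto simp: of_nat_diff algebra_simps)
    finally show "(\<Sum>(j, k) \<in> {(j, k). j \<ge> 1 \<and> k \<ge> 1 \<and> j + k = n}.
             of_rat (poly2 F (of_nat j) (of_nat k)) * zeta (2 * of_nat j) * zeta (2 * of_nat k)) =
          (\<Sum>k = 0..(d + 1) div 2. of_rat (poly (K k) (of_nat n)) *
             zeta (2 * of_nat k) * zeta (2 * of_nat n - 2 * of_nat k))" .
  qed
qed

end
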